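(* For all $0<\epsilon<\frac12$ and integers $1\le t\le n$, $$R^{\mathrm{oot}}_\epsilon(t\text{-}\mathrm{FtFD}_n)\in O\left(\log t+\log\log n+\log\tfrac1\epsilon\right),\qquad R^{\mathrm{uni}}_\epsilon(t\text{-}\mathrm{FtFD}_n)\in\Omega(\log n).$$
   Context: $B_2(n,t)=\{x\in\{0,1\}^n:\sum_i x_i\le t\}$. The $t$-Find the First Difference problem $t\text{-}\mathrm{FtFD}_n:B_2(n,t)\times B_2(n,t)\to\{0,\dots,n\}$ is $t\text{-}\mathrm{FtFD}_n(x,y)=\min(\{i:x_i\ne y_i\}\cup\{n\})$ (indices of the strings are $0,\dots,n-1$). Two-party communication with private randomness $r_A,r_B$, public randomness $r$, transcript $t_\pi$ (exchanged bits, public randomness excluded), cost = maximum number of bits exchanged. Output models with error $\epsilon$ (correct with probability at least $1-\epsilon$ on every input), output maps $O_A(t_\pi,r,r_A,x)$, $O_B(t_\pi,r,r_B,y)$: Alice (resp. Bob) model — $O_A=f(x,y)$ (resp. $O_B=f(x,y)$); one-out-of-two — values in $\mathcal Z\cup\{\top\}$ and $(O_A,O_B)\in\{(f(x,y),\top),(\top,f(x,y))\}$. $R^{\mathrm{oot}}_\epsilon$ is the minimum one-out-of-two cost and $R^{\mathrm{uni}}_\epsilon=\min(R^A_\epsilon,R^B_\epsilon)$ (public and private coins allowed). The $\Omega(\log n)$ holds for fixed $\epsilon$ as $n\to\infty$. Logarithms base 2. *)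

theory Defs
  imports "HOL-Probability.Probability" "HOL-Library.Extended_Nat"
begin

text \<open>
  Random strings are drawn from arbitrary discrete distributions and encoded as natural
  numbers.  On finite input sets this loses no generality.
\<close>

type_synonym rand = nat

text \<open>
  A protocol tree for a fixed public random string: at an internal node the owner sends
  a bit depending on its input and private randomness; on \<open>False\<close> the protocol moves to the
  first subtree, on \<open>True\<close> to the second.
\<close>

datatype ('x, 'y) ptree =
    Done
  | Alice_Sends "'x \<Rightarrow> rand \<Rightarrow> bool" "('x, 'y) ptree" "('x, 'y) ptree"
  | Bob_Sends "'y \<Rightarrow> rand \<Rightarrow> bool" "('x, 'y) ptree" "('x, 'y) ptree"

primrec run :: "('x, 'y) ptree \<Rightarrow> rand \<Rightarrow> rand \<Rightarrow> 'x \<Rightarrow> 'y \<Rightarrow> bool list" where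
  "run Done r\<^sub>A r\<^sub>B x y = []"
| "run (Alice_Sends f P Q) r\<^sub>A r\<^sub>B x y =
     f x r\<^sub>A # (if f x r\<^sub>A then run Q r\<^sub>A r\<^sub>B x y else run P r\<^sub>A r\<^sub>B x y)"
| "run (Bob_Sends g P Q) r\<^sub>A r\<^sub>B x y =
     g y r\<^sub>B # (if g y r\<^sub>B then run Q r\<^sub>A r\<^sub>B x y else run P r\<^sub>A r\<^sub>B x y)"

record ('x, 'y) protocol =
  public_coins :: "rand pmf"
  alice_coins :: "rand pmf"
  bob_coins :: "rand pmf"
  tree :: "rand \<Rightarrow> ('x, 'y) ptree"

definition coins :: "('x, 'y) protocol \<Rightarrow> (rand \<times> rand \<times> rand) pmf" where
  "coins \<pi> = pair_pmf (public_coins \<pi>) (pair_pmf (alice_coins \<pi>) (bob_coins \<pi>))"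

definition transcript ::
  "('x, 'y) protocol \<Rightarrow> rand \<Rightarrow> rand \<Rightarrow> rand \<Rightarrow> 'x \<Rightarrow> 'y \<Rightarrow> bool list" where
  "transcript \<pi> r r\<^sub>A r\<^sub>B x y = run (tree \<pi> r) r\<^sub>A r\<^sub>B x y"

text \<open>The cost is infinite if the number of exchanged bits is unbounded.\<close>

definition cost :: "'x set \<Rightarrow> 'y set \<Rightarrow> ('x, 'y) protocol \<Rightarrow> enat" where
  "cost X Y \<pi> =
     (SUP (x, y) \<in> X \<times> Y. SUP (r, r\<^sub>A, r\<^sub>B) \<in> set_pmf (coins \<pi>).
        enat (length (transcript \<pi> r r\<^sub>A r\<^sub>B x y)))"

text \<open>An output map takes the transcript, the public randomness, the party's own private
  randomness, and the party's own input.\<close>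

type_synonym ('i, 'o) output_map = "bool list \<Rightarrow> rand \<Rightarrow> rand \<Rightarrow> 'i \<Rightarrow> 'o"

definition computes_alice ::
  "real \<Rightarrow> 'x set \<Rightarrow> 'y set \<Rightarrow> ('x \<Rightarrow> 'y \<Rightarrow> 'z) \<Rightarrow> ('x, 'y) protocol \<Rightarrow> bool" where
  "computes_alice \<epsilon> X Y f \<pi> \<longleftrightarrow>
     (\<exists>O\<^sub>A :: ('x, 'z) output_map. \<forall>x\<in>X. \<forall>y\<in>Y.
        measure_pmf.prob (coins \<pi>)
          {(r, r\<^sub>A, r\<^sub>B). O\<^sub>A (transcript \<pi> r r\<^sub>A r\<^sub>B x y) r r\<^sub>A x = f x y} \<ge> 1 - \<epsilon>)"

definition computes_bob ::
  "real \<Rightarrow> 'x set \<Rightarrow> 'y set \<Rightarrow> ('x \<Rightarrow> 'y \<Rightarrow> 'z) \<Rightarrow> ('x, 'y) protocol \<Rightarrow> bool" where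
  "computes_bob \<epsilon> X Y f \<pi> \<longleftrightarrow>
     (\<exists>O\<^sub>B :: ('y, 'z) output_map. \<forall>x\<in>X. \<forall>y\<in>Y.
        measure_pmf.prob (coins \<pi>)
          {(r, r\<^sub>A, r\<^sub>B). O\<^sub>B (transcript \<pi> r r\<^sub>A r\<^sub>B x y) r r\<^sub>B y = f x y} \<ge> 1 - \<epsilon>)"

text \<open>In the one-out-of-two model the value \<open>None\<close> encodes the symbol \<open>\<top>\<close>.\<close>

definition computes_oot ::
  "real \<Rightarrow> 'x set \<Rightarrow> 'y set \<Rightarrow> ('x \<Rightarrow> 'y \<Rightarrow> 'z) \<Rightarrow> ('x, 'y) protocol \<Rightarrow> bool" where
  "computes_oot \<epsilon> X Y f \<pi> \<longleftrightarrow>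
     (\<exists>(O\<^sub>A :: ('x, 'z option) output_map) (O\<^sub>B :: ('y, 'z option) output_map).
        \<forall>x\<in>X. \<forall>y\<in>Y.
          measure_pmf.prob (coins \<pi>)
            {(r, r\<^sub>A, r\<^sub>B).
               (O\<^sub>A (transcript \<pi> r r\<^sub>A r\<^sub>B x y) r r\<^sub>A x, O\<^sub>B (transcript \<pi> r r\<^sub>A r\<^sub>B x y) r r\<^sub>B y)
                 \<in> {(Some (f x y), None), (None, Some (f x y))}} \<ge> 1 - \<epsilon>)"

definition R_alice :: "real \<Rightarrow> 'x set \<Rightarrow> 'y set \<Rightarrow> ('x \<Rightarrow> 'y \<Rightarrow> 'z) \<Rightarrow> nat" where
  "R_alice \<epsilon> X Y f = (LEAST c. \<exists>\<pi>. computes_alice \<epsilon> X Y f \<pi> \<and> cost X Y \<pi> = enat c)"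

definition R_bob :: "real \<Rightarrow> 'x set \<Rightarrow> 'y set \<Rightarrow> ('x \<Rightarrow> 'y \<Rightarrow> 'z) \<Rightarrow> nat" where
  "R_bob \<epsilon> X Y f = (LEAST c. \<exists>\<pi>. computes_bob \<epsilon> X Y f \<pi> \<and> cost X Y \<pi> = enat c)"

definition R_oot :: "real \<Rightarrow> 'x set \<Rightarrow> 'y set \<Rightarrow> ('x \<Rightarrow> 'y \<Rightarrow> 'z) \<Rightarrow> nat" where
  "R_oot \<epsilon> X Y f = (LEAST c. \<exists>\<pi>. computes_oot \<epsilon> X Y f \<pi> \<and> cost X Y \<pi> = enat c)"

definition R_uni :: "real \<Rightarrow> 'x set \<Rightarrow> 'y set \<Rightarrow> ('x \<Rightarrow> 'y \<Rightarrow> 'z) \<Rightarrow> nat" where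
  "R_uni \<epsilon> X Y f = min (R_alice \<epsilon> X Y f) (R_bob \<epsilon> X Y f)"

definition B2 :: "nat \<Rightarrow> nat \<Rightarrow> bool list set" where
  "B2 n t = {x. length x = n \<and> (\<Sum>i<n. of_bool (x ! i)) \<le> t}"

text \<open>The parameter \<open>t\<close> of the \<open>t\<close>-FtFD problem enters only through the input sets \<open>B2 n t\<close>.\<close>

definition FtFD :: "nat \<Rightarrow> bool list \<Rightarrow> bool list \<Rightarrow> nat" where
  "FtFD n x y = Min ({i. i < n \<and> x ! i \<noteq> y ! i} \<union> {n})"

end

theory Submission
  imports Defs
begin

text \<open>
  Upper bound: each party writes the positions of its ones as an increasing list, padded with \<open>n\<close> to
  length \<open>t\<close>, with \<open>m\<close> bits per entry where \<open>n < 2 ^ m\<close>.  If \<open>p\<close> is the first position at which the two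
  codes of length \<open>t * m\<close> differ, then the smaller of the two list entries containing \<open>p\<close> is the first
  difference of the inputs, and the party whose code bit at \<open>p\<close> is 0 knows that it owns it.  The position
  \<open>p\<close> is found with \<open>O(log (t * m) + log (1 / \<epsilon>))\<close> bits by a binary search that compares prefixes
  through constant-size random hashes and backtracks when a comparison reveals an earlier mistake.

  Lower bound: against the zero string, the unit strings produce \<open>n\<close> different answers.  For fixed
  coins the party holding the zero string gives at most one answer per transcript, so there must
  be at least \<open>n * (1 - \<epsilon>)\<close> transcripts.
\<close>

section \<open>Probability\<close>

text \<open>The law of total probability in the form used below: integrate a conditional bound that
  is \<open>b\<close> in general and rises by \<open>a\<close> on the event
  \<open>B\<close>.\<close>

lemma prob_bind_pmf_le:
  fixes f :: "'a \<Rightarrow> 'b pmf"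
  assumes "0 \<le> a" "0 \<le> b"
    and le: "\<And>x. x \<in> set_pmf p \<Longrightarrow> measure_pmf.prob (f x) E \<le> b + a * indicator B x"
  shows "measure_pmf.prob (bind_pmf p f) E \<le> b + a * measure_pmf.prob p B"
proof -
  have "ennreal (measure_pmf.prob (bind_pmf p f) E) = emeasure (bind_pmf p f) E"
    by (simp add: measure_pmf.emeasure_eq_measure)
  also have "\<dots> = (\<integral>\<^sup>+x. emeasure (f x) E \<partial>p)"
    by simp
  also have "\<dots> \<le> (\<integral>\<^sup>+x. ennreal b + ennreal a * indicator B x \<partial>p)"
  proof (rule nn_integral_mono_AE, rule AE_pmfI)
    fix x assume "x \<in> set_pmf p"
    hence "ennreal (measure_pmf.prob (f x) E) \<le> ennreal (b + a * indicator B x)"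
      by (intro ennreal_leI le)
    thus "emeasure (f x) E \<le> ennreal b + ennreal a * indicator B x"
      using assms(1,2)
      by (simp add: measure_pmf.emeasure_eq_measure ennreal_plus ennreal_mult ennreal_indicator)
  qed
  also have "\<dots> = ennreal b + ennreal a * emeasure p B"
    by (simp add: nn_integral_add nn_integral_cmult)
  also have "\<dots> = ennreal (b + a * measure_pmf.prob p B)"
    using assms(1,2)
    by (simp add: measure_pmf.emeasure_eq_measure ennreal_plus ennreal_mult)
  finally show ?thesis
    by (rule ennreal_le_iff[THEN iffD1, rotated]) (use assms(1,2) in simp)
qed

lemma prob_replicate_pmf_Suc:
  "measure_pmf.prob (replicate_pmf (Suc n) p) E =
     measure_pmf.prob (bind_pmf p (\<lambda>x. map_pmf (Cons x) (replicate_pmf n p))) E"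
  by (simp add: map_pmf_def)

text \<open>Values on \<open>A\<close> are independent and uniform. The default value has length
  \<open>c\<close> as well, so every hash value fills a message of exactly \<open>c\<close>
  bits.\<close>

definition random_hash :: "'a list set \<Rightarrow> nat \<Rightarrow> ('a list \<Rightarrow> bool list) pmf" where
  "random_hash A c = Pi_pmf A (replicate c False) (\<lambda>_. pmf_of_set {l. length l = c})"

lemma length_bool_lists:
  shows finite_bool_lists_length: "finite {l :: bool list. length l = c}"
    and card_bool_lists_length: "card {l :: bool list. length l = c} = 2 ^ c"
    and bool_lists_length_nonempty: "{l :: bool list. length l = c} \<noteq> {}"
proof -
  show "finite {l :: bool list. length l = c}"
    using finite_lists_length_eq[of "UNIV :: bool set" c] by simp
  show "card {l :: bool list. length l = c} = 2 ^ c"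
    using card_lists_length_eq[of "UNIV :: bool set" c] by simp
  show "{l :: bool list. length l = c} \<noteq> {}"
    by (auto intro: exI[of _ "replicate c False"])
qed

lemma length_random_hash:
  assumes "finite A" "h \<in> set_pmf (random_hash A c)"
  shows "length (h a) = c"
proof -
  have "h \<in> PiE_dflt A (replicate c False) (\<lambda>_. {l. length l = c})"
    using assms(2) set_Pi_pmf_subset'[OF assms(1), of "replicate c False"
        "\<lambda>_. pmf_of_set {l. length l = c}"] length_bool_lists[of c]
    unfolding random_hash_def by (auto simp: o_def)
  thus ?thesis
    by (cases "a \<in> A") (auto simp: PiE_dflt_def)
qed

text \<open>Drawing the value at \<open>a\<close> last makes it independent of the value at
  \<open>b\<close>, which it hits with probability at most \<open>1 / 2 ^ c\<close>. This also
  covers \<open>b\<close> outside \<open>A\<close>, where the hash takes its default value.\<close>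

lemma random_hash_collision:
  assumes "finite A" "a \<in> A" "a \<noteq> b"
  shows "measure_pmf.prob (random_hash A c) {h. h a = h b} \<le> 1 / 2 ^ c"
proof -
  let ?q = "pmf_of_set {l :: bool list. length l = c}"
  let ?P = "Pi_pmf (A - {a}) (replicate c False) (\<lambda>_. ?q)"
  have A: "A = insert a (A - {a})" using assms by auto
  have "random_hash A c = bind_pmf ?q (\<lambda>y. bind_pmf ?P (\<lambda>f. return_pmf (f(a := y))))"
    unfolding random_hash_def by (subst A, subst Pi_pmf_insert') (use assms in auto)
  also have "\<dots> = bind_pmf ?P (\<lambda>f. map_pmf (\<lambda>y. f(a := y)) ?q)"
    unfolding map_pmf_def by (rule bind_commute_pmf)
  finally have eq: "random_hash A c = \<dots>" .
  have "measure_pmf.prob (random_hash A c) {h. h a = h b}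
          \<le> 1 / 2 ^ c + 0 * measure_pmf.prob ?P {}"
    unfolding eq
  proof (rule prob_bind_pmf_le)
    fix f :: "'a list \<Rightarrow> bool list"
    have "measure_pmf.prob (map_pmf (\<lambda>y. f(a := y)) ?q) {h. h a = h b}
            = measure_pmf.prob ?q {f b}"
      using assms(3) by (auto simp: vimage_def intro!: arg_cong[where f = "measure_pmf.prob ?q"])
    also have "\<dots> \<le> 1 / 2 ^ c"
      using length_bool_lists[of c] by (simp add: measure_pmf_single indicator_def)
    finally show "measure_pmf.prob (map_pmf (\<lambda>y. f(a := y)) ?q) {h. h a = h b}
                    \<le> 1 / 2 ^ c + 0 * indicator {} f" by simp
  qed auto
  thus ?thesis by simp
qed


section \<open>Noisy binary search\<close>

text \<open>
  A bit list, most recent bit first, is a path from the root of the binary search tree over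
  \<open>{..<2 ^ D}\<close>.  Below depth \<open>D\<close> the tree continues with copies of the leaf, so that the walk
  can gain a margin against later errors.
\<close>

primrec lo :: "nat \<Rightarrow> bool list \<Rightarrow> nat" where
  "lo D [] = 0"
| "lo D (b # w) = lo D w + (if b then 2 ^ D div 2 ^ Suc (length w) else 0)"

definition mid :: "nat \<Rightarrow> bool list \<Rightarrow> nat" where
  "mid D w = lo D w + 2 ^ D div 2 ^ Suc (length w)"

text \<open>The interval is half open. Below depth \<open>D\<close> the quotient is 0, and
  \<open>max 1\<close> keeps the leaf interval at length 1.\<close>

definition hi :: "nat \<Rightarrow> bool list \<Rightarrow> nat" where
  "hi D w = lo D w + max 1 (2 ^ D div 2 ^ length w)"

abbreviation encloses :: "nat \<Rightarrow> bool list \<Rightarrow> nat \<Rightarrow> bool" where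
  "encloses D w p \<equiv> lo D w \<le> p \<and> p < hi D w"

lemma interval_children:
  shows lo_left: "lo D (False # w) = lo D w"
    and lo_right: "lo D (True # w) = mid D w"
    and hi_left: "length w < D \<Longrightarrow> hi D (False # w) = mid D w"
    and hi_right: "length w < D \<Longrightarrow> hi D (True # w) = hi D w"
    and lo_leaf: "D \<le> length w \<Longrightarrow> lo D (b # w) = lo D w"
    and hi_leaf: "D \<le> length w \<Longrightarrow> hi D (b # w) = hi D w"
    and mid_leaf: "D \<le> length w \<Longrightarrow> mid D w = lo D w"
proof -
  show "hi D (False # w) = mid D w" "hi D (True # w) = hi D w" if l: "length w < D"
  proof -
    obtain e where D: "D = length w + Suc e" using l less_iff_Suc_add by fastforce
    show "hi D (False # w) = mid D w" "hi D (True # w) = hi D w"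
      by (simp_all add: hi_def mid_def D power_add)
  qed
  have small: "(2::nat) ^ D div 2 ^ Suc k = 0" if "D \<le> k" for k
    using that by (intro div_less power_strict_increasing) auto
  have "max 1 ((2::nat) ^ D div 2 ^ k) = 1" if "D \<le> k" for k
    using that div_le_mono2[of "2 ^ D" "2 ^ k" "2 ^ D :: nat"] by (simp add: power_increasing)
  thus "lo D (b # w) = lo D w" "hi D (b # w) = hi D w" "mid D w = lo D w" if "D \<le> length w"
    using that small[of "length w"] unfolding hi_def mid_def by auto
qed (auto simp: mid_def)

lemma encloses_child:
  assumes "encloses D w p"
  shows "encloses D ((mid D w \<le> p) # w) p"
  using assms
  by (cases "length w < D"; cases "mid D w \<le> p")
     (auto simp: interval_children simp del: lo.simps)

lemma encloses_parent:
  assumes "encloses D (b # w) p"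
  shows "encloses D w p"
proof (cases "length w < D")
  case True
  have "lo D w \<le> mid D w" "mid D w \<le> hi D w"
    by (auto simp: mid_def hi_def le_max_iff_disj intro!: div_le_mono2)
  thus ?thesis using assms True by (cases b) (auto simp: interval_children simp del: lo.simps)
qed (use assms in \<open>auto simp: interval_children simp del: lo.simps\<close>)

lemma encloses_leaf:
  assumes "encloses D w p" "D \<le> length w"
  shows "lo D w = p"
proof -
  have "(2::nat) ^ D div 2 ^ length w \<le> 1"
    using assms(2) div_le_mono2[of "2 ^ D" "2 ^ length w" "2 ^ D :: nat"] by (simp add: power_increasing)
  thus ?thesis using assms(1) by (auto simp: hi_def)
qed

text \<open>
  A correct step divides the potential by 4 and a wrong one, which has probability at most 1/16,
  multiplies it by at most 4, so it halves in expectation: \<open>1 / 4 + 4 / 16 = 1 / 2\<close>.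
\<close>

primrec potential :: "nat \<Rightarrow> nat \<Rightarrow> bool list \<Rightarrow> real" where
  "potential D p [] = 1"
| "potential D p (b # w) = potential D p w * (if encloses D (b # w) p then 1 / 4 else 4)"

lemma potential_pos: "0 < potential D p w"
  by (induction w) auto

lemma potential_path: "encloses D w p \<Longrightarrow> potential D p w = (1 / 4) ^ length w"
proof (induction w)
  case (Cons b w)
  thus ?case using encloses_parent[OF Cons.prems] by (simp del: lo.simps)
qed simp

text \<open>A path enclosing \<open>p\<close> has potential exactly
  \<open>(1 / 4) ^ length w\<close>, so a small potential forces depth \<open>D\<close>. A last bit
  that loses \<open>p\<close> multiplies the potential by 4, so by induction the rest of the path
  would already sit at the right leaf, whose copies cannot lose \<open>p\<close>.\<close>

lemma potential_small:
  assumes "potential D p w \<le> (1 / 4) ^ D" "p < 2 ^ D"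
  shows "encloses D w p \<and> D \<le> length w"
  using assms(1)
proof (induction w)
  case Nil
  have "D = 0"
  proof (rule ccontr)
    assume "D \<noteq> 0"
    hence "(1 / 4 :: real) ^ D < 1" by (intro power_less_one_iff[THEN iffD2]) auto
    thus False using Nil by simp
  qed
  thus ?case using assms(2) by (simp add: hi_def)
next
  case (Cons b w)
  show ?case
  proof (cases "encloses D (b # w) p")
    case True
    hence "(1 / 4 :: real) ^ length (b # w) \<le> (1 / 4) ^ D"
      using Cons.prems potential_path[OF True] by simp
    hence "D \<le> length (b # w)"
      by (subst (asm) power_decreasing_iff) auto
    thus ?thesis using True by blast
  next
    case False
    hence "potential D p (b # w) = potential D p w * 4"
      by (auto simp del: lo.simps)
    hence "potential D p w \<le> (1 / 4) ^ D"
      using Cons.prems potential_pos[of D p w] by linarith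
    with Cons.IH have "encloses D w p" "D \<le> length w" by auto
    hence "encloses D (b # w) p" by (auto simp: interval_children simp del: lo.simps)
    thus ?thesis using False by blast
  qed
qed

text \<open>The arguments answer whether \<open>p\<close> is at or beyond the lower end, the upper
  end and the midpoint. Inside the interval the walk descends; otherwise it drops its latest bit,
  staying put at the root since \<open>tl [] = []\<close>.\<close>

definition move :: "bool \<Rightarrow> bool \<Rightarrow> bool \<Rightarrow> bool list \<Rightarrow> bool list" where
  "move l h m w = (if l \<and> \<not> h then m # w else tl w)"

lemma potential_move_le: "potential D p (move l h m w) \<le> 4 * potential D p w"
proof -
  have "potential D p (b # w) \<le> 4 * potential D p w" for b
    using potential_pos[of D p w] by (auto simp del: lo.simps split: if_splits)
  moreover have "potential D p (tl w) \<le> 4 * potential D p w"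
    using potential_pos[of D p "tl w"] by (cases w) (auto simp del: lo.simps)
  ultimately show ?thesis by (auto simp: move_def simp del: potential.simps)
qed

text \<open>If \<open>p\<close> is enclosed, the chosen child encloses it and adds a factor 1/4. If
  not, the walk is below the root and its latest bit carries a factor 4, which backtracking
  removes.\<close>

lemma potential_correct_move:
  assumes "p < 2 ^ D"
  shows "potential D p (move (lo D w \<le> p) (hi D w \<le> p) (mid D w \<le> p) w) = potential D p w / 4"
proof (cases "encloses D w p")
  case True
  thus ?thesis using encloses_child[OF True] by (simp add: move_def del: lo.simps)
next
  case False
  hence "w \<noteq> []" using assms by (auto simp: hi_def)
  then obtain b w' where "w = b # w'" by (cases w) auto
  thus ?thesis using False by (auto simp: move_def simp del: lo.simps)
qed

text \<open>One hash serves all three tests of a step; their errors are later combined by a union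
  bound.\<close>

definition hash_step ::
  "nat \<Rightarrow> 'a list \<Rightarrow> 'a list \<Rightarrow> ('a list \<Rightarrow> bool list) \<Rightarrow> bool list \<Rightarrow> bool list" where
  "hash_step D u v h w =
     (let eq = (\<lambda>q. h (take q u) = h (take q v)) in move (eq (lo D w)) (eq (hi D w)) (eq (mid D w)) w)"

section \<open>First differences and their detection by prefix comparison\<close>

lemma FtFD_le: "FtFD n x y \<le> n"
  unfolding FtFD_def by (rule Min_le) auto

lemma FtFD_less:
  assumes "i < FtFD n x y"
  shows "x ! i = y ! i"
proof (rule ccontr)
  assume neq: "x ! i \<noteq> y ! i"
  have "i < n" using assms FtFD_le[of n x y] by simp
  hence "FtFD n x y \<le> i" unfolding FtFD_def using neq by (intro Min_le) auto
  thus False using assms by simp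
qed

lemma FtFD_diff:
  assumes "FtFD n x y < n"
  shows "x ! FtFD n x y \<noteq> y ! FtFD n x y"
proof -
  have "FtFD n x y \<in> {i. i < n \<and> x ! i \<noteq> y ! i} \<union> {n}"
    unfolding FtFD_def by (rule Min_in) auto
  thus ?thesis using assms by auto
qed

lemma FtFD_eqI:
  assumes "i \<le> n" "\<And>j. j < i \<Longrightarrow> x ! j = y ! j" "i < n \<Longrightarrow> x ! i \<noteq> y ! i"
  shows "FtFD n x y = i"
proof (rule antisym)
  show "FtFD n x y \<le> i"
    using FtFD_less[of i n x y] FtFD_le[of n x y] assms(1,3) by (cases "i < n") force+
  show "i \<le> FtFD n x y"
    using FtFD_diff[of n x y] assms(1) assms(2)[of "FtFD n x y"]
    by (meson le_trans not_le)
qed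

text \<open>Prefix tests thus answer the comparisons of the binary search. A first difference below
  \<open>L\<close> makes this hold even for \<open>q > L\<close>, where \<open>take\<close> returns
  the whole strings.\<close>

lemma take_eq_iff_le_FtFD:
  assumes "length u = L" "length v = L" "FtFD L u v < L"
  shows "take q u = take q v \<longleftrightarrow> q \<le> FtFD L u v"
proof
  assume eq: "take q u = take q v"
  show "q \<le> FtFD L u v"
  proof (rule ccontr)
    assume "\<not> q \<le> FtFD L u v"
    hence "u ! FtFD L u v = v ! FtFD L u v"
      using nth_take[of "FtFD L u v" q u] nth_take[of "FtFD L u v" q v] eq by simp
    thus False using FtFD_diff[OF assms(3)] by simp
  qed
next
  assume "q \<le> FtFD L u v"
  thus "take q u = take q v"
    using assms by (intro nth_equalityI) (auto intro!: FtFD_less[of _ L])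
qed

text \<open>Equal prefixes hash equally, so a test errs only through a collision, which has
  probability at most \<open>1 / 64\<close> with 6 hash bits. Three tests give at most
  \<open>3 / 64\<close>, below \<open>1 / 16\<close>.\<close>

lemma prob_bad_step:
  fixes u v :: "bool list"
  assumes "length u = L" "length v = L" "FtFD L u v < L" "L \<le> 2 ^ D"
    and "finite A" "\<And>q. take q u \<in> A"
  defines "p \<equiv> FtFD L u v"
  shows "measure_pmf.prob (random_hash A 6)
           {h. potential D p (hash_step D u v h w) > potential D p w / 4} \<le> 1 / 16"
proof -
  define C where "C q = {h :: bool list \<Rightarrow> bool list. \<not> (h (take q u) = h (take q v) \<longrightarrow> q \<le> p)}" for q
  let ?M = "random_hash A 6"
  note eq_iff = take_eq_iff_le_FtFD[OF assms(1-3), folded p_def]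
  have C: "measure_pmf.prob ?M (C q) \<le> 1 / 64" for q
  proof (cases "q \<le> p")
    case True
    hence "C q = {}" by (auto simp: C_def)
    thus ?thesis by simp
  next
    case False
    hence "C q = {h. h (take q u) = h (take q v)}" by (auto simp: C_def)
    thus ?thesis using random_hash_collision[OF assms(5,6), of q "take q v" 6] False eq_iff by simp
  qed
  have "p < 2 ^ D" using assms(3,4) by (simp add: p_def)
  have "potential D p (hash_step D u v h w) = potential D p w / 4"
    if "h \<notin> C (lo D w) \<union> (C (hi D w) \<union> C (mid D w))" for h
  proof -
    have "h (take q u) = h (take q v) \<longleftrightarrow> q \<le> p" if "h \<notin> C q" for q
      using that eq_iff[of q] by (auto simp: C_def)
    thus ?thesis
      using potential_correct_move[OF \<open>p < 2 ^ D\<close>, of w] that by (simp add: hash_step_def)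
  qed
  hence "{h. potential D p (hash_step D u v h w) > potential D p w / 4}
           \<subseteq> C (lo D w) \<union> (C (hi D w) \<union> C (mid D w))"
    by force
  hence "measure_pmf.prob ?M {h. potential D p (hash_step D u v h w) > potential D p w / 4}
           \<le> measure_pmf.prob ?M (C (lo D w) \<union> (C (hi D w) \<union> C (mid D w)))"
    by (intro measure_pmf.finite_measure_mono) auto
  also have "\<dots> \<le> measure_pmf.prob ?M (C (lo D w))
      + (measure_pmf.prob ?M (C (hi D w)) + measure_pmf.prob ?M (C (mid D w)))"
    by (intro order_trans[OF measure_Un_le] add_left_mono) auto
  also have "\<dots> \<le> 1 / 16"
    using C[of "lo D w"] C[of "hi D w"] C[of "mid D w"] by simp
  finally show ?thesis .
qed

text \<open>Markov's inequality, unrolled over the rounds: a wrong final position has potential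
  above \<open>(1 / 4) ^ D\<close>, while each round at least halves the expected potential.\<close>

lemma prob_search_fails:
  fixes u v :: "bool list"
  assumes "length u = L" "length v = L" "FtFD L u v < L" "L \<le> 2 ^ D"
    and "finite A" "\<And>q. take q u \<in> A"
  shows "measure_pmf.prob (replicate_pmf T (random_hash A 6))
           {hs. lo D (fold (hash_step D u v) hs w) \<noteq> FtFD L u v}
         \<le> 4 ^ D / 2 ^ T * potential D (FtFD L u v) w"
proof (induction T arbitrary: w)
  case 0
  let ?p = "FtFD L u v"
  have "?p < 2 ^ D" using assms(3,4) by simp
  show ?case
  proof (cases "lo D w = ?p")
    case True
    thus ?thesis using potential_pos[of D ?p w] by simp
  next
    case False
    hence "(1 / 4) ^ D < potential D ?p w"
      using potential_small[OF _ \<open>?p < 2 ^ D\<close>] encloses_leaf by (meson not_le)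
    hence "1 < 4 ^ D * potential D ?p w"
      by (simp add: power_one_over field_simps)
    thus ?thesis using False by simp
  qed
next
  case (Suc T)
  let ?p = "FtFD L u v" and ?M = "random_hash A 6"
  let ?E = "{hs. lo D (fold (hash_step D u v) hs w) \<noteq> ?p}"
  define B where "B = {h. potential D ?p (hash_step D u v h w) > potential D ?p w / 4}"
  define a where "a = 4 ^ D / 2 ^ T * potential D ?p w"
  have a: "0 \<le> a" unfolding a_def using potential_pos[of D ?p w] by simp
  \<comment> \<open>A good round contributes \<open>a / 4\<close>, a bad one at most
    \<open>4 * a\<close>. Since \<open>B\<close> has probability at most \<open>1 / 16\<close>, the
    total is at most \<open>a / 2\<close>.\<close>
  have "measure_pmf.prob (replicate_pmf (Suc T) ?M) ?E \<le> a / 4 + 4 * a * measure_pmf.prob ?M B"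
    unfolding prob_replicate_pmf_Suc
  proof (rule prob_bind_pmf_le)
    fix h
    let ?w = "hash_step D u v h w"
    have "measure_pmf.prob (map_pmf ((#) h) (replicate_pmf T ?M)) ?E
            = measure_pmf.prob (replicate_pmf T ?M) {hs. lo D (fold (hash_step D u v) hs ?w) \<noteq> ?p}"
      by (simp add: vimage_def)
    also have "\<dots> \<le> 4 ^ D / 2 ^ T * potential D ?p ?w"
      by (rule Suc.IH)
    also have "\<dots> \<le> 4 ^ D / 2 ^ T * (if h \<in> B then 4 * potential D ?p w else potential D ?p w / 4)"
      using potential_move_le[of D ?p]
      by (intro mult_left_mono) (auto simp: B_def hash_step_def Let_def)
    also have "\<dots> \<le> a / 4 + 4 * a * indicator B h"
      using a by (auto simp: a_def)
    finally show "measure_pmf.prob (map_pmf ((#) h) (replicate_pmf T ?M)) ?E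
                    \<le> a / 4 + 4 * a * indicator B h" .
  qed (use a in auto)
  also have "\<dots> \<le> a / 4 + 4 * a * (1 / 16)"
    using prob_bad_step[OF assms, where w=w] a unfolding B_def by (intro add_left_mono mult_left_mono) auto
  also have "\<dots> = 4 ^ D / 2 ^ Suc T * potential D ?p w"
    by (simp add: a_def)
  finally show ?case .
qed


section \<open>Protocol trees\<close>

primrec alice_sends ::
  "nat \<Rightarrow> ('x \<Rightarrow> bool list) \<Rightarrow> (bool list \<Rightarrow> ('x, 'y) ptree) \<Rightarrow> ('x, 'y) ptree" where
  "alice_sends 0 f k = k []"
| "alice_sends (Suc n) f k =
     Alice_Sends (\<lambda>x _. hd (f x))
       (alice_sends n (\<lambda>x. tl (f x)) (\<lambda>m. k (False # m)))
       (alice_sends n (\<lambda>x. tl (f x)) (\<lambda>m. k (True # m)))"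

primrec bob_sends ::
  "nat \<Rightarrow> ('y \<Rightarrow> bool list) \<Rightarrow> (bool list \<Rightarrow> ('x, 'y) ptree) \<Rightarrow> ('x, 'y) ptree" where
  "bob_sends 0 f k = k []"
| "bob_sends (Suc n) f k =
     Bob_Sends (\<lambda>y _. hd (f y))
       (bob_sends n (\<lambda>y. tl (f y)) (\<lambda>m. k (False # m)))
       (bob_sends n (\<lambda>y. tl (f y)) (\<lambda>m. k (True # m)))"

lemma run_alice_sends:
  assumes "length (f x) = n"
  shows "run (alice_sends n f k) r\<^sub>A r\<^sub>B x y = f x @ run (k (f x)) r\<^sub>A r\<^sub>B x y"
  using assms
proof (induction n arbitrary: f k)
  case (Suc n)
  then obtain b m where "f x = b # m" by (cases "f x") auto
  thus ?case using Suc by (cases b) auto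
qed simp

lemma run_bob_sends:
  assumes "length (f y) = n"
  shows "run (bob_sends n f k) r\<^sub>A r\<^sub>B x y = f y @ run (k (f y)) r\<^sub>A r\<^sub>B x y"
  using assms
proof (induction n arbitrary: f k)
  case (Suc n)
  then obtain b m where "f y = b # m" by (cases "f y") auto
  thus ?case using Suc by (cases b) auto
qed simp

section \<open>From protocol trees to bounds on communication cost\<close>

lemma cost_le:
  assumes "\<And>x y r r\<^sub>A r\<^sub>B. \<lbrakk>x \<in> X; y \<in> Y; (r, r\<^sub>A, r\<^sub>B) \<in> set_pmf (coins \<pi>)\<rbrakk>
             \<Longrightarrow> length (transcript \<pi> r r\<^sub>A r\<^sub>B x y) \<le> c"
  shows "\<exists>c' \<le> c. cost X Y \<pi> = enat c'"
proof -
  have "cost X Y \<pi> \<le> enat c"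
    unfolding cost_def using assms by (auto intro!: SUP_least)
  thus ?thesis by (cases "cost X Y \<pi>") auto
qed

lemma length_transcript_le_cost:
  assumes "cost X Y \<pi> = enat c" "x \<in> X" "y \<in> Y" "(r, r\<^sub>A, r\<^sub>B) \<in> set_pmf (coins \<pi>)"
  shows "length (transcript \<pi> r r\<^sub>A r\<^sub>B x y) \<le> c"
proof -
  have "enat (length (transcript \<pi> r r\<^sub>A r\<^sub>B x y)) \<le> cost X Y \<pi>"
    unfolding cost_def
    by (rule SUP_upper2[where i = "(x, y)"], use assms in simp,
        unfold prod.case, rule SUP_upper2[where i = "(r, r\<^sub>A, r\<^sub>B)"]) (use assms in auto)
  thus ?thesis using assms(1) by simp
qed

text \<open>The public randomness may have any type, since a \<open>pmf\<close> has countable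
  support and can be encoded in the naturals. Private coins are fixed to 0.\<close>

lemma R_oot_le:
  fixes p :: "'r pmf" and P :: "'r \<Rightarrow> ('x, 'y) ptree"
    and O\<^sub>A :: "bool list \<Rightarrow> 'x \<Rightarrow> 'z option" and O\<^sub>B :: "bool list \<Rightarrow> 'y \<Rightarrow> 'z option"
  assumes len: "\<And>r x y. \<lbrakk>r \<in> set_pmf p; x \<in> X; y \<in> Y\<rbrakk> \<Longrightarrow> length (run (P r) 0 0 x y) \<le> c"
    and correct: "\<And>x y. \<lbrakk>x \<in> X; y \<in> Y\<rbrakk> \<Longrightarrow>
      1 - \<epsilon> \<le> measure_pmf.prob p
        {r. (O\<^sub>A (run (P r) 0 0 x y) x, O\<^sub>B (run (P r) 0 0 x y) y) \<in> {(Some (f x y), None), (None, Some (f x y))}}"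
  shows "R_oot \<epsilon> X Y f \<le> c"
proof -
  let ?enc = "to_nat_on (set_pmf p)" and ?dec = "from_nat_into (set_pmf p)"
  define \<pi> :: "('x, 'y) protocol" where
    "\<pi> = \<lparr>public_coins = map_pmf ?enc p, alice_coins = return_pmf 0, bob_coins = return_pmf 0,
           tree = \<lambda>k. P (?dec k)\<rparr>"
  have coins: "coins \<pi> = map_pmf (\<lambda>r. (?enc r, 0, 0)) p"
    by (simp add: coins_def \<pi>_def pair_return_pmf1 pair_return_pmf2 map_pmf_comp)
  have tr: "transcript \<pi> k r\<^sub>A r\<^sub>B x y = run (P (?dec k)) r\<^sub>A r\<^sub>B x y" for k r\<^sub>A r\<^sub>B x y
    by (simp add: transcript_def \<pi>_def)
  have "\<exists>c' \<le> c. cost X Y \<pi> = enat c'"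
    by (rule cost_le) (auto simp: coins tr len)
  then obtain c' where c': "c' \<le> c" "cost X Y \<pi> = enat c'" by blast
  have "computes_oot \<epsilon> X Y f \<pi>"
    unfolding computes_oot_def
  proof (rule exI[of _ "\<lambda>t _ _. O\<^sub>A t"], rule exI[of _ "\<lambda>t _ _. O\<^sub>B t"], intro ballI)
    fix x y assume xy: "x \<in> X" "y \<in> Y"
    let ?ok = "\<lambda>t. (O\<^sub>A t x, O\<^sub>B t y) \<in> {(Some (f x y), None), (None, Some (f x y))}"
    have "measure_pmf.prob (coins \<pi>) {(r, r\<^sub>A, r\<^sub>B). ?ok (transcript \<pi> r r\<^sub>A r\<^sub>B x y)}
            = measure_pmf.prob p {r. ?ok (run (P (?dec (?enc r))) 0 0 x y)}"
      by (simp add: coins tr vimage_def)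
    \<comment> \<open>Decoding inverts encoding only on the support of \<open>p\<close>, so the two
      events agree almost surely.\<close>
    also have "\<dots> = measure_pmf.prob p {r. ?ok (run (P r) 0 0 x y)}"
      by (rule measure_pmf.finite_measure_eq_AE) (auto intro!: AE_pmfI)
    finally show "1 - \<epsilon> \<le> measure_pmf.prob (coins \<pi>)
        {(r, r\<^sub>A, r\<^sub>B). ?ok (transcript \<pi> r r\<^sub>A r\<^sub>B x y)}"
      using correct[OF xy] by simp
  qed
  with c'(2) have "R_oot \<epsilon> X Y f \<le> c'"
    unfolding R_oot_def by (intro Least_le) blast
  with c'(1) show ?thesis by simp
qed


section \<open>The one-out-of-two protocol\<close>

text \<open>Bob's reply puts the outcome on the transcript, so both parties follow the same branch
  of the search.\<close>

definition hash_test ::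
  "('x \<Rightarrow> bool list) \<Rightarrow> ('y \<Rightarrow> bool list) \<Rightarrow> (bool list \<Rightarrow> bool list) \<Rightarrow> nat
    \<Rightarrow> (bool \<Rightarrow> ('x, 'y) ptree) \<Rightarrow> ('x, 'y) ptree" where
  "hash_test u v h q k =
     alice_sends 6 (\<lambda>x. h (take q (u x)))
       (\<lambda>m. Bob_Sends (\<lambda>y _. m = h (take q (v y))) (k False) (k True))"

primrec search_tree ::
  "nat \<Rightarrow> ('x \<Rightarrow> bool list) \<Rightarrow> ('y \<Rightarrow> bool list) \<Rightarrow> (bool list \<Rightarrow> bool list) list \<Rightarrow> bool list
    \<Rightarrow> ('x, 'y) ptree" where
  "search_tree D u v [] w = Done"
| "search_tree D u v (h # hs) w =
     hash_test u v h (lo D w) (\<lambda>a. hash_test u v h (hi D w) (\<lambda>b. hash_test u v h (mid D w) (\<lambda>c.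
       search_tree D u v hs (move a b c w))))"

text \<open>
  A round of three tests occupies 21 transcript bits, with Bob's answers at positions 6, 13 and 20.
  Both parties can therefore recover the final search path from the transcript.
\<close>

primrec replay :: "nat \<Rightarrow> bool list \<Rightarrow> bool list \<Rightarrow> bool list" where
  "replay 0 s w = w"
| "replay (Suc T) s w = replay T (drop 21 s) (move (s ! 6) (s ! 13) (s ! 20) w)"

lemma run_hash_test:
  assumes "\<And>l. length (h l) = 6"
  shows "run (hash_test u v h q k) r\<^sub>A r\<^sub>B x y =
    (let b = (h (take q (u x)) = h (take q (v y)))
     in h (take q (u x)) @ b # run (k b) r\<^sub>A r\<^sub>B x y)"
  unfolding hash_test_def Let_def by (subst run_alice_sends) (auto simp: assms)

lemma run_search_tree:
  assumes "\<And>h l. h \<in> set hs \<Longrightarrow> length (h l) = 6"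
  shows "length (run (search_tree D u v hs w) r\<^sub>A r\<^sub>B x y) = 21 * length hs \<and>
         replay (length hs) (run (search_tree D u v hs w) r\<^sub>A r\<^sub>B x y) w
           = fold (hash_step D (u x) (v y)) hs w"
  using assms
proof (induction hs arbitrary: w)
  case (Cons h hs)
  let ?s = "\<lambda>hs w. run (search_tree D u v hs w) r\<^sub>A r\<^sub>B x y"
  have h: "length (h l) = 6" for l using Cons.prems by simp
  let ?eq = "\<lambda>q. h (take q (u x)) = h (take q (v y))"
  let ?w = "move (?eq (lo D w)) (?eq (hi D w)) (?eq (mid D w)) w"
  have eq: "?s (h # hs) w =
      (h (take (lo D w) (u x)) @ [?eq (lo D w)]) @ (h (take (hi D w) (u x)) @ [?eq (hi D w)])
      @ (h (take (mid D w) (u x)) @ [?eq (mid D w)]) @ ?s hs ?w"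
    by (simp add: run_hash_test[OF h] Let_def)
  have "length (?s hs ?w) = 21 * length hs"
    "replay (length hs) (?s hs ?w) ?w = fold (hash_step D (u x) (v y)) hs ?w"
    using Cons by auto
  moreover have "hash_step D (u x) (v y) h w = ?w"
    by (simp add: hash_step_def)
  ultimately show ?case
    by (simp add: eq h nth_append del: search_tree.simps)
qed simp


subsection \<open>Encoding sparse strings\<close>

text \<open>The padding value \<open>n\<close> exceeds every position, so where one list of ones
  ends early it has the larger entry.\<close>

definition support_list :: "nat \<Rightarrow> nat \<Rightarrow> bool list \<Rightarrow> nat list" where
  "support_list n t x = take t (filter (\<lambda>i. x ! i) [0..<n] @ replicate t n)"

lemma length_support_list [simp]: "length (support_list n t x) = t"
  by (simp add: support_list_def)

lemma support_list_le: "i < t \<Longrightarrow> support_list n t x ! i \<le> n"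
  using nth_mem[of i "filter (\<lambda>i. x ! i) [0..<n]"]
  by (auto simp: support_list_def nth_append)

lemma B2_support_size:
  assumes "x \<in> B2 n t"
  shows "length (filter (\<lambda>i. x ! i) [0..<n]) \<le> t"
proof -
  have "length (filter (\<lambda>i. x ! i) [0..<n]) = card (set (filter (\<lambda>i. x ! i) [0..<n]))"
    by (intro distinct_card[symmetric]) simp
  also have "set (filter (\<lambda>i. x ! i) [0..<n]) = {..<n} \<inter> {i. x ! i}"
    by auto
  also have "card \<dots> = (\<Sum>i<n. of_bool (x ! i))"
    by (simp add: of_bool_def sum.If_cases Int_def)
  finally show ?thesis using assms by (simp add: B2_def)
qed

lemma mem_support_list:
  assumes "x \<in> B2 n t" "a < n"
  shows "a \<in> set (support_list n t x) \<longleftrightarrow> x ! a"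
  using B2_support_size[OF assms(1)] assms(2)
  by (auto simp: support_list_def)

lemma support_list_strict:
  assumes "i < j" "j < t" "support_list n t x ! j < n"
  shows "support_list n t x ! i < support_list n t x ! j"
proof -
  let ?l = "filter (\<lambda>i. x ! i) [0..<n]"
  have j: "j < length ?l"
    using assms by (auto simp: support_list_def nth_append split: if_splits)
  have "sorted_wrt (<) ?l"
    by (intro sorted_wrt_filter) simp
  hence "?l ! i < ?l ! j"
    using assms(1) j by (simp add: sorted_wrt_nth_less)
  thus ?thesis using assms(1,2) j by (simp add: support_list_def nth_append)
qed

lemma FtFD_commute: "FtFD n x y = FtFD n y x"
  by (simp add: FtFD_def eq_commute)

text \<open>Positions below the smaller entry occur in either list only before index
  \<open>j\<close>, where the lists coincide. The smaller entry is absent from the other list: it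
  could only occur there before \<open>j\<close>, and would then occur twice in its own list,
  against strict monotonicity.\<close>

lemma FtFD_support_list:
  assumes x: "x \<in> B2 n t" and y: "y \<in> B2 n t" and "j < t"
    and same: "\<And>i. i < j \<Longrightarrow> support_list n t x ! i = support_list n t y ! i"
    and less: "support_list n t x ! j < support_list n t y ! j"
  shows "FtFD n x y = support_list n t x ! j"
proof -
  let ?X = "support_list n t x" and ?Y = "support_list n t y"
  have jn: "?X ! j < n" using less support_list_le[OF \<open>j < t\<close>, of n y] by simp
  have before: "a \<in> set ?X \<longleftrightarrow> a \<in> set ?Y" if a: "a < ?X ! j" for a
  proof
    assume "a \<in> set ?X"
    then obtain i where i: "i < t" "?X ! i = a" by (auto simp: in_set_conv_nth)
    have "i < j"
      using support_list_strict[of j i t n x] i a jn by (cases i j rule: linorder_cases) auto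
    thus "a \<in> set ?Y" using same[of i] i by (metis nth_mem length_support_list)
  next
    assume "a \<in> set ?Y"
    then obtain i where i: "i < t" "?Y ! i = a" by (auto simp: in_set_conv_nth)
    have "i < j"
      using support_list_strict[of j i t n y] i a jn less by (cases i j rule: linorder_cases) auto
    thus "a \<in> set ?X" using same[of i] i by (metis nth_mem length_support_list)
  qed
  have "?X ! j \<notin> set ?Y"
  proof
    assume "?X ! j \<in> set ?Y"
    then obtain i where i: "i < t" "?Y ! i = ?X ! j" by (auto simp: in_set_conv_nth)
    have "i < j"
      using support_list_strict[of j i t n y] i jn less by (cases i j rule: linorder_cases) auto
    thus False using same[of i] i support_list_strict[of i j t n x] jn \<open>j < t\<close> by simp
  qed
  moreover have "?X ! j \<in> set ?X" using \<open>j < t\<close> by simp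
  ultimately show ?thesis
    using before jn mem_support_list[OF x] mem_support_list[OF y]
    by (intro FtFD_eqI) (force simp: less_imp_le)+
qed

text \<open>
  Each entry of the list is written with its most significant bit first.  At the first differing
  code bit the party holding 0 therefore has the smaller entry, which is the answer.
\<close>

definition support_code :: "nat \<Rightarrow> nat \<Rightarrow> nat \<Rightarrow> bool list \<Rightarrow> bool list" where
  "support_code n t m x =
     map (\<lambda>p. bit (support_list n t x ! (p div m)) (m - 1 - p mod m)) [0..<t * m]"

lemma length_support_code [simp]: "length (support_code n t m x) = t * m"
  by (simp add: support_code_def)

lemma nth_support_code:
  assumes "i < t" "b < m"
  shows "support_code n t m x ! (i * m + (m - 1 - b)) = bit (support_list n t x ! i) b"
    and "i * m + (m - 1 - b) < t * m"
proof -
  have "i * m + m \<le> t * m"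
    using assms(1) by (metis add.commute mult_Suc mult_le_mono1 Suc_leI)
  thus "i * m + (m - 1 - b) < t * m" using assms(2) by simp
  moreover have "(i * m + r) div m = i" "(i * m + r) mod m = r" if "r < m" for r
    using that by simp_all
  from this[of "m - 1 - b"] have "(i * m + (m - 1 - b)) div m = i" "(i * m + (m - 1 - b)) mod m = m - 1 - b"
    using assms(2) by linarith+
  ultimately show "support_code n t m x ! (i * m + (m - 1 - b)) = bit (support_list n t x ! i) b"
    using assms(2) by (simp add: support_code_def del: diff_diff_left)
qed

section \<open>Reading off the answer from the first differing code bit\<close>

lemma bit_nat_imp_less:
  fixes a :: nat
  assumes "a < 2 ^ m" "bit a b"
  shows "b < m"
  using assms by (metis bit_take_bit_iff take_bit_nat_eq_self)

text \<open>Above bit \<open>q\<close> the numbers agree, so after division by \<open>2 ^ q\<close>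
  they differ only in parity, and the even quotient is the smaller.\<close>

lemma less_if_first_bit_less:
  fixes a b :: nat
  assumes "\<And>j. q < j \<Longrightarrow> bit a j = bit b j" "\<not> bit a q" "bit b q"
  shows "a < b"
proof -
  have "drop_bit (Suc q) a = drop_bit (Suc q) b"
    by (rule bit_eqI) (simp add: bit_drop_bit_eq assms(1))
  hence "a div 2 ^ q div 2 = b div 2 ^ q div 2"
    by (simp add: drop_bit_eq_div div_mult2_eq power_Suc2 del: power_Suc)
  moreover have "even (a div 2 ^ q)" "odd (b div 2 ^ q)"
    using assms(2,3) by (auto simp: bit_iff_odd)
  ultimately have "a div 2 ^ q < b div 2 ^ q" by (auto elim!: evenE oddE)
  thus ?thesis using div_le_mono[of b a "2 ^ q"] by (meson not_le)
qed

text \<open>The code stores only the bits below \<open>m\<close>; the condition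
  \<open>n < 2 ^ m\<close> makes all higher bits of the entries vanish.\<close>

lemma support_list_eq_if_code_eq:
  assumes "n < 2 ^ m" "i < t"
    and eq: "\<And>b. b < m \<Longrightarrow> support_code n t m x ! (i * m + (m - 1 - b))
                            = support_code n t m y ! (i * m + (m - 1 - b))"
  shows "support_list n t x ! i = support_list n t y ! i"
proof (rule bit_eqI)
  fix b
  have "b < m" if "bit (support_list n t z ! i) b" for z
    using bit_nat_imp_less[OF _ that, of m] support_list_le[OF assms(2), of n z] assms(1) by simp
  moreover have "bit (support_list n t x ! i) b = bit (support_list n t y ! i) b" if "b < m"
    using eq[OF that] nth_support_code[OF assms(2) that] by simp
  ultimately show "bit (support_list n t x ! i) b = bit (support_list n t y ! i) b"
    by blast
qed

text \<open>Earlier entries agree, as do the more significant bits of entry \<open>p div m\<close>.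
  The code bit at \<open>p\<close> is 0 for \<open>x\<close> and 1 for \<open>y\<close>, so
  \<open>x\<close> has the smaller entry.\<close>

lemma FtFD_support_code_less:
  assumes x: "x \<in> B2 n t" and y: "y \<in> B2 n t" and "n < 2 ^ m"
    and p: "p = FtFD (t * m) (support_code n t m x) (support_code n t m y)" "p < t * m"
    and "\<not> support_code n t m x ! p"
  shows "FtFD n x y = support_list n t x ! (p div m)"
proof -
  let ?X = "support_code n t m x" and ?Y = "support_code n t m y"
  define j where "j = p div m"
  define q where "q = m - 1 - p mod m"
  have "0 < m" using p(2) by (cases m) auto
  hence "j < t" "q < m"
    using p(2) by (auto simp: j_def q_def less_mult_imp_div_less)
  have "m - 1 - q = p mod m"
    unfolding q_def using \<open>0 < m\<close> mod_less_divisor[of m p] by linarith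
  hence p_eq: "p = j * m + (m - 1 - q)" by (simp add: j_def)
  have before: "?X ! i = ?Y ! i" if "i < p" for i
    using that p(1) FtFD_less by blast
  have diff: "?X ! p \<noteq> ?Y ! p" using FtFD_diff p by blast
  have "support_list n t x ! j < support_list n t y ! j"
  proof (rule less_if_first_bit_less)
    show "\<not> bit (support_list n t x ! j) q" "bit (support_list n t y ! j) q"
      using nth_support_code(1)[OF \<open>j < t\<close> \<open>q < m\<close>, of n] diff assms(6) by (auto simp: p_eq)
    fix b assume "q < b"
    have "b < m" if "bit (support_list n t z ! j) b" for z
      using bit_nat_imp_less[OF _ that, of m] support_list_le[OF \<open>j < t\<close>, of n z] assms(3) by simp
    moreover have "bit (support_list n t x ! j) b = bit (support_list n t y ! j) b" if "b < m"
      using before[of "j * m + (m - 1 - b)"] that \<open>q < b\<close> nth_support_code(1)[OF \<open>j < t\<close> that, of n]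
      by (simp add: p_eq)
    ultimately show "bit (support_list n t x ! j) b = bit (support_list n t y ! j) b"
      by blast
  qed
  moreover have "support_list n t x ! i = support_list n t y ! i" if "i < j" for i
  proof (rule support_list_eq_if_code_eq[OF assms(3)])
    show "i < t" using that \<open>j < t\<close> by simp
    fix b assume "b < m"
    have "i * m + m \<le> j * m"
      using that by (metis add.commute mult_Suc mult_le_mono1 Suc_leI)
    thus "?X ! (i * m + (m - 1 - b)) = ?Y ! (i * m + (m - 1 - b))"
      using \<open>b < m\<close> by (intro before) (simp add: p_eq)
  qed
  ultimately show ?thesis
    using FtFD_support_list[OF x y \<open>j < t\<close>] by (simp add: j_def)
qed

lemma FtFD_support_code_eq:
  assumes x: "x \<in> B2 n t" and y: "y \<in> B2 n t" and "n < 2 ^ m"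
    and "FtFD (t * m) (support_code n t m x) (support_code n t m y) = t * m"
  shows "FtFD n x y = n"
proof (rule FtFD_eqI)
  have "support_list n t x = support_list n t y"
  proof (rule nth_equalityI)
    fix i assume "i < length (support_list n t x)"
    hence "i < t" by simp
    show "support_list n t x ! i = support_list n t y ! i"
      by (rule support_list_eq_if_code_eq[OF assms(3) \<open>i < t\<close>], rule FtFD_less[of _ "t * m"])
        (simp only: assms(4) nth_support_code(2)[OF \<open>i < t\<close>])
  qed simp
  thus "x ! j = y ! j" if "j < n" for j
    using mem_support_list[OF x that] mem_support_list[OF y that] by simp
qed auto

text \<open>Distinct final bits guarantee a first difference inside the strings, as the search
  demands. Equal codes then show up as the answer \<open>k\<close>.\<close>

lemma FtFD_sentinel:
  assumes "length u = k" "length v = k"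
  shows "FtFD (Suc k) (u @ [True]) (v @ [False]) = FtFD k u v"
  using assms FtFD_le[of k u v] FtFD_diff[of k u v] FtFD_less[of _ k u v]
  by (intro FtFD_eqI) (auto simp: nth_append)

theorem R_oot_FtFD_le:
  assumes "n < 2 ^ m" "t * m + 1 \<le> 2 ^ D" "0 < \<epsilon>" "1 / \<epsilon> \<le> 2 ^ e"
  shows "R_oot \<epsilon> (B2 n t) (B2 n t) (FtFD n) \<le> 21 * (2 * D + e)"
proof -
  \<comment> \<open>With this number of rounds the failure bound \<open>4 ^ D / 2 ^ T\<close>
    becomes \<open>1 / 2 ^ e\<close>, which is at most \<open>\<epsilon>\<close>.\<close>
  define T where "T = 2 * D + e"
  define L where "L = Suc (t * m)"
  define A where "A = {l :: bool list. length l \<le> L}"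
  define code where "code = support_code n t m"
  define u where "u = (\<lambda>x. code x @ [True])"
  define v where "v = (\<lambda>y. code y @ [False])"
  define found where "found s = lo D (replay T s [])" for s
  \<comment> \<open>For equal codes Alice answers \<open>n\<close> by convention. Otherwise, after a
    correct search, the code bits at the found position differ, so exactly one party sees 0 and
    answers.\<close>
  define O\<^sub>A where "O\<^sub>A s x =
    (if found s = t * m then Some n
     else if code x ! found s then None else Some (support_list n t x ! (found s div m)))" for s x
  define O\<^sub>B where "O\<^sub>B s y =
    (if found s = t * m \<or> code y ! found s then None
     else Some (support_list n t y ! (found s div m)))" for s y
  let ?p = "replicate_pmf T (random_hash A 6)"
  let ?run = "\<lambda>hs x y. run (search_tree D u v hs []) 0 0 x y"
  have A: "finite A"
    unfolding A_def using finite_lists_length_le[of "UNIV :: bool set" L] by simp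
  have run: "length (?run hs x y) = 21 * T"
    "found (?run hs x y) = lo D (fold (hash_step D (u x) (v y)) hs [])"
    if "hs \<in> set_pmf ?p" for hs x y
  proof -
    have T: "length hs = T"
      using that by (simp add: set_replicate_pmf)
    have six: "length (h l) = 6" if "h \<in> set hs" for h l
      using \<open>hs \<in> set_pmf ?p\<close> that length_random_hash[OF A] by (auto simp: set_replicate_pmf)
    show "length (?run hs x y) = 21 * T"
      "found (?run hs x y) = lo D (fold (hash_step D (u x) (v y)) hs [])"
      using run_search_tree[of hs D u v "[]" 0 0 x y] six T by (auto simp: found_def)
  qed
  have "R_oot \<epsilon> (B2 n t) (B2 n t) (FtFD n) \<le> 21 * T"
  proof (rule R_oot_le[where p = ?p and P = "\<lambda>hs. search_tree D u v hs []" and O\<^sub>A = O\<^sub>A and O\<^sub>B = O\<^sub>B])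
    fix x y assume x: "x \<in> B2 n t" and y: "y \<in> B2 n t"
    define q where "q = FtFD L (u x) (v y)"
    have q: "q = FtFD (t * m) (code x) (code y)"
      unfolding q_def L_def u_def v_def by (rule FtFD_sentinel) (auto simp: code_def)
    hence "q \<le> t * m" using FtFD_le by simp
    have ok: "(O\<^sub>A s x, O\<^sub>B s y) \<in> {(Some (FtFD n x y), None), (None, Some (FtFD n x y))}"
      if s: "found s = q" for s
    proof (cases "q = t * m")
      case True
      thus ?thesis
        using FtFD_support_code_eq[OF x y assms(1)] q s by (simp add: O\<^sub>A_def O\<^sub>B_def code_def)
    next
      case False
      hence "q < t * m" using \<open>q \<le> t * m\<close> by simp
      have "code x ! q \<noteq> code y ! q" using FtFD_diff \<open>q < t * m\<close> q by simp
      moreover have "FtFD n x y = support_list n t x ! (q div m)" if "\<not> code x ! q"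
        using FtFD_support_code_less[OF x y assms(1) _ \<open>q < t * m\<close>] q that by (simp add: code_def)
      moreover have "FtFD n x y = support_list n t y ! (q div m)" if "\<not> code y ! q"
        using FtFD_support_code_less[OF y x assms(1) _ \<open>q < t * m\<close>] q that
        by (simp add: code_def FtFD_commute)
      ultimately show ?thesis
        using False s by (auto simp: O\<^sub>A_def O\<^sub>B_def)
    qed
    have "measure_pmf.prob ?p {hs. lo D (fold (hash_step D (u x) (v y)) hs []) \<noteq> q}
            \<le> 4 ^ D / 2 ^ T * potential D q []"
      unfolding q_def
    proof (rule prob_search_fails[OF _ _ _ _ A])
      show "FtFD L (u x) (v y) < L"
        using \<open>q \<le> t * m\<close> unfolding q_def by (simp only: L_def less_Suc_eq_le)
      show "take q (u x) \<in> A" for q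
        by (simp add: A_def u_def code_def L_def)
    qed (use assms(2) in \<open>auto simp: u_def v_def code_def L_def\<close>)
    also have "4 ^ D / 2 ^ T * potential D q [] = 1 / 2 ^ e"
      by (simp add: T_def power_add power_mult)
    also have "\<dots> \<le> \<epsilon>"
      using assms(3,4) by (simp add: field_simps)
    finally have "1 - \<epsilon> \<le> measure_pmf.prob ?p {hs. lo D (fold (hash_step D (u x) (v y)) hs []) = q}"
      using measure_pmf.prob_compl[of "{hs. lo D (fold (hash_step D (u x) (v y)) hs []) = q}" ?p]
      by (simp add: Compl_eq_Diff_UNIV[symmetric] Collect_neg_eq[symmetric])
    also have "\<dots> \<le> measure_pmf.prob ?p {hs. (O\<^sub>A (?run hs x y) x, O\<^sub>B (?run hs x y) y)
        \<in> {(Some (FtFD n x y), None), (None, Some (FtFD n x y))}}"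
      by (intro measure_pmf.finite_measure_mono_AE AE_pmfI impI) (use run(2) ok in auto)
    finally show "1 - \<epsilon> \<le> \<dots>" .
  qed (use run(1) in auto)
  thus ?thesis by (simp add: T_def)
qed


section \<open>Lower bound\<close>

text \<open>\<open>LEAST\<close> is informative only if some protocol of finite cost exists; here
  Bob sends his whole input and Alice evaluates \<open>f\<close>.\<close>

lemma R_alice_attained:
  fixes X :: "'x set" and Y :: "bool list set"
  assumes "\<And>y. y \<in> Y \<Longrightarrow> length y = n" "0 \<le> \<epsilon>"
  shows "\<exists>\<pi>. computes_alice \<epsilon> X Y f \<pi> \<and> cost X Y \<pi> = enat (R_alice \<epsilon> X Y f)"
proof -
  define \<pi> :: "('x, bool list) protocol" where
    "\<pi> = \<lparr>public_coins = return_pmf 0, alice_coins = return_pmf 0, bob_coins = return_pmf 0,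
           tree = \<lambda>_. bob_sends n id (\<lambda>_. Done)\<rparr>"
  have tr: "transcript \<pi> r r\<^sub>A r\<^sub>B x y = y" if "y \<in> Y" for r r\<^sub>A r\<^sub>B x y
    using that assms(1) by (simp add: transcript_def \<pi>_def run_bob_sends)
  have "\<exists>c \<le> n. cost X Y \<pi> = enat c"
    by (rule cost_le) (simp add: tr assms(1))
  moreover have "computes_alice \<epsilon> X Y f \<pi>"
    unfolding computes_alice_def
    by (rule exI[of _ "\<lambda>t _ _ x. f x t"]) (simp add: tr assms(2) case_prod_unfold)
  ultimately show ?thesis
    unfolding R_alice_def by (intro LeastI_ex[of "\<lambda>c. \<exists>\<pi>. computes_alice \<epsilon> X Y f \<pi> \<and> cost X Y \<pi> = enat c"]) blast
qed

lemma R_bob_attained: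
  fixes X :: "bool list set" and Y :: "'y set"
  assumes "\<And>x. x \<in> X \<Longrightarrow> length x = n" "0 \<le> \<epsilon>"
  shows "\<exists>\<pi>. computes_bob \<epsilon> X Y f \<pi> \<and> cost X Y \<pi> = enat (R_bob \<epsilon> X Y f)"
proof -
  define \<pi> :: "(bool list, 'y) protocol" where
    "\<pi> = \<lparr>public_coins = return_pmf 0, alice_coins = return_pmf 0, bob_coins = return_pmf 0,
           tree = \<lambda>_. alice_sends n id (\<lambda>_. Done)\<rparr>"
  have tr: "transcript \<pi> r r\<^sub>A r\<^sub>B x y = x" if "x \<in> X" for r r\<^sub>A r\<^sub>B x y
    using that assms(1) by (simp add: transcript_def \<pi>_def run_alice_sends)
  have "\<exists>c \<le> n. cost X Y \<pi> = enat c"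
    by (rule cost_le) (simp add: tr assms(1))
  moreover have "computes_bob \<epsilon> X Y f \<pi>"
    unfolding computes_bob_def
    by (rule exI[of _ "\<lambda>t _ _ y. f t y"]) (simp add: tr assms(2) case_prod_unfold)
  ultimately show ?thesis
    unfolding R_bob_def by (intro LeastI_ex[of "\<lambda>c. \<exists>\<pi>. computes_bob \<epsilon> X Y f \<pi> \<and> cost X Y \<pi> = enat c"]) blast
qed

text \<open>For fixed \<open>w\<close> the strings \<open>s i w\<close> that decode to their own
  index are distinct, so there are fewer than \<open>2 ^ Suc c\<close> of them. Averaging over
  \<open>w\<close> bounds the sum of the success probabilities, which is at least
  \<open>n * (1 - \<epsilon>)\<close>.\<close>

lemma decoding_bound:
  fixes p :: "'w pmf" and s :: "nat \<Rightarrow> 'w \<Rightarrow> bool list"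
  assumes correct: "\<And>i. i < n \<Longrightarrow> 1 - \<epsilon> \<le> measure_pmf.prob p {w. g w (s i w) = i}"
    and len: "\<And>i w. \<lbrakk>i < n; w \<in> set_pmf p\<rbrakk> \<Longrightarrow> length (s i w) \<le> c"
  shows "real n * (1 - \<epsilon>) \<le> 2 ^ Suc c"
proof -
  let ?S = "\<lambda>w. \<Sum>i<n. indicator {w. g w (s i w) = i} w :: real"
  have int: "integrable p (indicator E :: 'w \<Rightarrow> real)" for E
    by (rule measure_pmf.integrable_const_bound[of _ 1]) (auto simp: indicator_def)
  have "?S w \<le> 2 ^ Suc c" if "w \<in> set_pmf p" for w
  proof -
    let ?I = "{i. i < n \<and> g w (s i w) = i}"
    let ?L = "{l :: bool list. length l \<le> c}"
    have fin: "finite ?L" and card: "card ?L = 2 ^ Suc c - 1"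
      using finite_lists_length_le[of "UNIV :: bool set" c] card_lists_length_le[of "UNIV :: bool set" c]
      by (simp_all add: sum_power2 atMost_atLeast0 atLeastLessThanSuc_atLeastAtMost[symmetric])
    have "inj_on (\<lambda>i. s i w) ?I" by (rule inj_onI) (metis (mono_tags) mem_Collect_eq)
    hence "card ?I \<le> card ?L"
      by (rule card_inj_on_le) (use len that fin in auto)
    moreover have "?S w = real (card ?I)"
      by (simp add: indicator_def sum.If_cases Int_def flip: of_bool_def)
    moreover have "real (card ?L) \<le> 2 ^ Suc c" by (simp add: card)
    ultimately show ?thesis by linarith
  qed
  hence "measure_pmf.expectation p ?S \<le> measure_pmf.expectation p (\<lambda>_. 2 ^ Suc c)"
    by (intro integral_mono_AE AE_pmfI Bochner_Integration.integrable_sum int) auto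
  moreover have "measure_pmf.expectation p ?S = (\<Sum>i<n. measure_pmf.prob p {w. g w (s i w) = i})"
    by (subst Bochner_Integration.integral_sum) (auto intro: int)
  moreover have "real n * (1 - \<epsilon>) \<le> (\<Sum>i<n. measure_pmf.prob p {w. g w (s i w) = i})"
    using sum_mono[of "{..<n}" "\<lambda>_. 1 - \<epsilon>", OF correct] by simp
  ultimately show ?thesis by simp
qed

section \<open>Hard inputs: the zero string against the unit strings\<close>

lemma zeros_in_B2: "replicate n False \<in> B2 n t"
proof -
  have "(\<Sum>i<n. of_bool (replicate n False ! i)) = (0 :: nat)"
    by (rule sum.neutral) simp
  thus ?thesis by (simp add: B2_def del: sum_of_bool_eq)
qed

lemma unit_in_B2:
  assumes "i < n" "1 \<le> t"
  shows "(replicate n False)[i := True] \<in> B2 n t"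
proof -
  have "(\<Sum>j<n. of_bool ((replicate n False)[i := True] ! j)) = (\<Sum>j<n. of_bool (j = i) :: nat)"
    by (rule sum.cong) (auto simp: nth_list_update)
  also have "\<dots> = 1"
    using assms(1) by (simp add: of_bool_def)
  finally show ?thesis using assms(2) by (simp add: B2_def)
qed

lemma FtFD_zeros_unit:
  assumes "i < n"
  shows "FtFD n (replicate n False) ((replicate n False)[i := True]) = i"
  using assms by (intro FtFD_eqI) auto

text \<open>Alice holds the zero string for every \<open>i\<close>, so for fixed coins her output
  depends on Bob's unit string only through the transcript.\<close>

lemma R_alice_FtFD_ge:
  assumes "0 \<le> \<epsilon>" "1 \<le> t"
  shows "real n * (1 - \<epsilon>) \<le> 2 ^ Suc (R_alice \<epsilon> (B2 n t) (B2 n t) (FtFD n))"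
proof -
  let ?B = "B2 n t" and ?x = "replicate n False"
  let ?e = "\<lambda>i. ?x[i := True]"
  obtain \<pi> O\<^sub>A where cost: "cost ?B ?B \<pi> = enat (R_alice \<epsilon> ?B ?B (FtFD n))"
    and correct: "\<And>x y. \<lbrakk>x \<in> ?B; y \<in> ?B\<rbrakk> \<Longrightarrow> 1 - \<epsilon> \<le> measure_pmf.prob (coins \<pi>)
      {(r, r\<^sub>A, r\<^sub>B). O\<^sub>A (transcript \<pi> r r\<^sub>A r\<^sub>B x y) r r\<^sub>A x = FtFD n x y}"
    using R_alice_attained[of ?B n \<epsilon> ?B "FtFD n"] assms(1)
    by (auto simp: computes_alice_def B2_def)
  show ?thesis
  proof (rule decoding_bound[where p = "coins \<pi>"
        and s = "\<lambda>i (r, r\<^sub>A, r\<^sub>B). transcript \<pi> r r\<^sub>A r\<^sub>B ?x (?e i)" and g = "\<lambda>(r, r\<^sub>A, r\<^sub>B) t. O\<^sub>A t r r\<^sub>A ?x"])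
    fix i assume "i < n"
    thus "1 - \<epsilon> \<le> measure_pmf.prob (coins \<pi>) {w. (case w of (r, r\<^sub>A, r\<^sub>B) \<Rightarrow> \<lambda>t. O\<^sub>A t r r\<^sub>A ?x)
        (case w of (r, r\<^sub>A, r\<^sub>B) \<Rightarrow> transcript \<pi> r r\<^sub>A r\<^sub>B ?x (?e i)) = i}"
      using correct[OF zeros_in_B2 unit_in_B2[OF \<open>i < n\<close> assms(2)]] FtFD_zeros_unit[OF \<open>i < n\<close>]
      by (simp add: case_prod_unfold)
  next
    fix i w assume "i < n" "w \<in> set_pmf (coins \<pi>)"
    thus "length (case w of (r, r\<^sub>A, r\<^sub>B) \<Rightarrow> transcript \<pi> r r\<^sub>A r\<^sub>B ?x (?e i)) \<le> R_alice \<epsilon> ?B ?B (FtFD n)"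
      using length_transcript_le_cost[OF cost zeros_in_B2 unit_in_B2[OF _ assms(2)]]
      by (cases w) auto
  qed
qed

lemma R_bob_FtFD_ge:
  assumes "0 \<le> \<epsilon>" "1 \<le> t"
  shows "real n * (1 - \<epsilon>) \<le> 2 ^ Suc (R_bob \<epsilon> (B2 n t) (B2 n t) (FtFD n))"
proof -
  let ?B = "B2 n t" and ?y = "replicate n False"
  let ?e = "\<lambda>i. ?y[i := True]"
  obtain \<pi> O\<^sub>B where cost: "cost ?B ?B \<pi> = enat (R_bob \<epsilon> ?B ?B (FtFD n))"
    and correct: "\<And>x y. \<lbrakk>x \<in> ?B; y \<in> ?B\<rbrakk> \<Longrightarrow> 1 - \<epsilon> \<le> measure_pmf.prob (coins \<pi>)
      {(r, r\<^sub>A, r\<^sub>B). O\<^sub>B (transcript \<pi> r r\<^sub>A r\<^sub>B x y) r r\<^sub>B y = FtFD n x y}"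
    using R_bob_attained[of ?B n \<epsilon> ?B "FtFD n"] assms(1)
    by (auto simp: computes_bob_def B2_def)
  show ?thesis
  proof (rule decoding_bound[where p = "coins \<pi>"
        and s = "\<lambda>i (r, r\<^sub>A, r\<^sub>B). transcript \<pi> r r\<^sub>A r\<^sub>B (?e i) ?y" and g = "\<lambda>(r, r\<^sub>A, r\<^sub>B) t. O\<^sub>B t r r\<^sub>B ?y"])
    fix i assume "i < n"
    thus "1 - \<epsilon> \<le> measure_pmf.prob (coins \<pi>) {w. (case w of (r, r\<^sub>A, r\<^sub>B) \<Rightarrow> \<lambda>t. O\<^sub>B t r r\<^sub>B ?y)
        (case w of (r, r\<^sub>A, r\<^sub>B) \<Rightarrow> transcript \<pi> r r\<^sub>A r\<^sub>B (?e i) ?y) = i}"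
      using correct[OF unit_in_B2[OF \<open>i < n\<close> assms(2)] zeros_in_B2] FtFD_zeros_unit[OF \<open>i < n\<close>]
      by (simp add: case_prod_unfold FtFD_commute[of n "?e i"])
  next
    fix i w assume "i < n" "w \<in> set_pmf (coins \<pi>)"
    thus "length (case w of (r, r\<^sub>A, r\<^sub>B) \<Rightarrow> transcript \<pi> r r\<^sub>A r\<^sub>B (?e i) ?y) \<le> R_bob \<epsilon> ?B ?B (FtFD n)"
      using length_transcript_le_cost[OF cost unit_in_B2[OF _ assms(2)] zeros_in_B2]
      by (cases w) auto
  qed
qed

theorem R_uni_FtFD_ge:
  assumes "0 \<le> \<epsilon>" "\<epsilon> < 1 / 2" "1 \<le> t" "1 \<le> n"
  shows "log 2 n - 2 \<le> R_uni \<epsilon> (B2 n t) (B2 n t) (FtFD n)"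
proof -
  have "log 2 n - 2 \<le> real c" if "real n * (1 - \<epsilon>) \<le> 2 ^ Suc c" for c
  proof -
    have "real n * (1 / 2) \<le> real n * (1 - \<epsilon>)"
      using assms(2) by (intro mult_left_mono) auto
    \<comment> \<open>One factor 2 comes from \<open>1 - \<epsilon> > 1 / 2\<close>, the other from
      counting all strings of length up to \<open>c\<close>.\<close>
    hence "real n \<le> 2 ^ (c + 2)" using that by simp
    hence "log 2 (real n) \<le> log 2 (2 ^ (c + 2))"
      using assms(4) by (intro log_mono) auto
    also have "\<dots> = real (c + 2)" by (subst log_nat_power) auto
    finally show ?thesis by simp
  qed
  thus ?thesis
    using R_alice_FtFD_ge[OF assms(1,3), of n] R_bob_FtFD_ge[OF assms(1,3), of n]
    by (simp add: R_uni_def min_def)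
qed


section \<open>The separation\<close>

lemma ex_power2_ge:
  assumes "1 \<le> (x :: real)"
  shows "\<exists>k :: nat. x \<le> 2 ^ k \<and> real k \<le> log 2 x + 1"
proof (intro exI conjI)
  let ?k = "nat \<lceil>log 2 x\<rceil>"
  have nonneg: "0 \<le> log 2 x" using assms by simp
  have "x = 2 powr log 2 x" using assms by simp
  also have "\<dots> \<le> 2 powr real ?k" by (intro powr_mono) (auto intro: real_nat_ceiling_ge)
  finally show "x \<le> 2 ^ ?k" by (simp add: powr_realpow)
  show "real ?k \<le> log 2 x + 1" using nonneg by linarith
qed

text \<open>For \<open>n \<le> 1\<close> the iterated logarithm is 0, since \<open>ln 0 = 0\<close>.\<close>

lemma log2_log2_nonneg: "0 \<le> log 2 (log 2 (real n))"
proof (cases "2 \<le> n")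
  case True
  hence "1 \<le> log 2 (real n)" by (subst le_log_iff) auto
  thus ?thesis by simp
next
  case False
  hence "n = 0 \<or> n = 1" by auto
  thus ?thesis by (auto simp: log_def)
qed

lemma R_oot_FtFD_bound:
  assumes "0 < \<epsilon>" "\<epsilon> < 1 / 2" "1 \<le> t" "1 \<le> n"
  shows "real (R_oot \<epsilon> (B2 n t) (B2 n t) (FtFD n))
           \<le> 210 * (log 2 (real t) + log 2 (log 2 (real n)) + log 2 (1 / \<epsilon>))"
proof -
  obtain m :: nat where m: "real (n + 1) \<le> 2 ^ m" "real m \<le> log 2 (real (n + 1)) + 1"
    using ex_power2_ge[of "real (n + 1)"] by auto
  obtain D :: nat where D: "real (t * m + 1) \<le> 2 ^ D" "real D \<le> log 2 (real (t * m + 1)) + 1"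
    using ex_power2_ge[of "real (t * m + 1)"] by auto
  obtain e :: nat where e: "1 / \<epsilon> \<le> 2 ^ e" "real e \<le> log 2 (1 / \<epsilon>) + 1"
    using ex_power2_ge[of "1 / \<epsilon>"] assms(1,2) by auto
  have nm: "n < 2 ^ m"
    using m(1) by (metis Suc_eq_plus1 Suc_le_lessD of_nat_le_iff of_nat_numeral of_nat_power)
  have tmD: "t * m + 1 \<le> 2 ^ D"
    using D(1) by (metis of_nat_le_iff of_nat_numeral of_nat_power)
  have "1 \<le> m" using nm assms(4) by (cases m) auto
  have log_m: "log 2 (real m) \<le> 2 + log 2 (log 2 (real n))"
  proof (cases "n = 1")
    \<comment> \<open>Here \<open>log 2 n\<close> is 0 and cannot dominate \<open>m\<close>, but
      \<open>m\<close> is at most 2.\<close>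
    case True
    hence "log 2 (real m) \<le> log 2 2"
      using m(2) \<open>1 \<le> m\<close> by (intro log_mono) auto
    moreover have "log 2 (log 2 (real n)) = 0"
      using True by (simp add: log_def)
    ultimately show ?thesis by simp
  next
    case False
    hence "2 \<le> n" using assms(4) by simp
    hence l: "1 \<le> log 2 (real n)" by (subst le_log_iff) auto
    have "log 2 (real (n + 1)) \<le> log 2 (2 * real n)"
      using assms(4) by (intro log_mono) auto
    also have "\<dots> = 1 + log 2 (real n)"
      using assms(4) by (simp add: log_mult)
    finally have "real m \<le> 4 * log 2 (real n)" using m(2) l by linarith
    hence "log 2 (real m) \<le> log 2 (4 * log 2 (real n))"
      using \<open>1 \<le> m\<close> by (intro log_mono) auto
    also have "\<dots> = log 2 (2 ^ 2) + log 2 (log 2 (real n))"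
      using l by (subst log_mult) auto
    also have "log 2 ((2 :: real) ^ 2) = 2"
      by (subst log_nat_power) auto
    finally show ?thesis .
  qed
  have "1 * 1 \<le> real t * real m" using \<open>1 \<le> m\<close> assms(3) by (intro mult_mono) auto
  hence "log 2 (real (t * m + 1)) \<le> log 2 (2 * (real t * real m))"
    by (intro log_mono) (auto simp: mult.commute)
  also have "\<dots> = 1 + (log 2 (real t) + log 2 (real m))"
    using \<open>1 \<le> m\<close> assms(3) by (simp add: log_mult)
  finally have D': "real D \<le> 4 + log 2 (real t) + log 2 (log 2 (real n))"
    using D(2) log_m by simp
  have "1 = log 2 (2 :: real)" by simp
  also have "\<dots> \<le> log 2 (1 / \<epsilon>)"
    using assms(1,2) by (intro log_mono) (auto simp: field_simps)
  finally have le: "1 \<le> log 2 (1 / \<epsilon>)" .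
  have "0 \<le> log 2 (real t)" using assms(3) by simp
  have "real (R_oot \<epsilon> (B2 n t) (B2 n t) (FtFD n)) \<le> real (21 * (2 * D + e))"
    using R_oot_FtFD_le[OF nm tmD assms(1) e(1)] by (simp only: of_nat_le_iff)
  also have "\<dots> = 42 * real D + 21 * real e" by simp
  also have "\<dots> \<le> 210 * (log 2 (real t) + log 2 (log 2 (real n)) + log 2 (1 / \<epsilon>))"
  proof -
    \<comment> \<open>The additive constants \<open>42 * 4 + 21\<close> are absorbed by
      \<open>c\<close>, which is at least 1; with its own coefficient 21 this makes 210.\<close>
    have "42 * d + 21 * k \<le> 210 * (a + b + c)"
      if "d \<le> 4 + a + b" "k \<le> c + 1" "1 \<le> c" "0 \<le> a" "0 \<le> b" for a b c d k :: real
      using that by (simp add: algebra_simps)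
    from this[OF D' e(2) le \<open>0 \<le> log 2 (real t)\<close> log2_log2_nonneg[of n]] show ?thesis .
  qed
  finally show ?thesis .
qed

theorem mainTheorem19:
  shows "(\<exists>C::real. \<forall>(\<epsilon>::real) (t::nat) (n::nat).
            0 < \<epsilon> \<and> \<epsilon> < 1/2 \<and> 1 \<le> t \<and> t \<le> n \<longrightarrow>
            real (R_oot \<epsilon> (B2 n t) (B2 n t) (FtFD n))
              \<le> C * (log 2 (real t) + log 2 (log 2 (real n)) + log 2 (1 / \<epsilon>)))
       \<and> (\<forall>\<epsilon>::real. 0 < \<epsilon> \<and> \<epsilon> < 1/2 \<longrightarrow>
            (\<exists>c>0. \<exists>N::nat. \<forall>(n::nat) (t::nat). N \<le> n \<and> 1 \<le> t \<and> t \<le> n \<longrightarrow>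
               c * log 2 (real n) \<le> real (R_uni \<epsilon> (B2 n t) (B2 n t) (FtFD n))))"
proof (intro conjI)
  show "\<exists>C::real. \<forall>(\<epsilon>::real) (t::nat) (n::nat).
            0 < \<epsilon> \<and> \<epsilon> < 1/2 \<and> 1 \<le> t \<and> t \<le> n \<longrightarrow>
            real (R_oot \<epsilon> (B2 n t) (B2 n t) (FtFD n))
              \<le> C * (log 2 (real t) + log 2 (log 2 (real n)) + log 2 (1 / \<epsilon>))"
    using R_oot_FtFD_bound by (intro exI[of _ 210]) auto
  show "\<forall>\<epsilon>::real. 0 < \<epsilon> \<and> \<epsilon> < 1/2 \<longrightarrow>
            (\<exists>c>0. \<exists>N::nat. \<forall>(n::nat) (t::nat). N \<le> n \<and> 1 \<le> t \<and> t \<le> n \<longrightarrow>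
               c * log 2 (real n) \<le> real (R_uni \<epsilon> (B2 n t) (B2 n t) (FtFD n)))"
  proof (intro allI impI)
    fix \<epsilon> :: real assume \<epsilon>: "0 < \<epsilon> \<and> \<epsilon> < 1/2"
    have "1 / 2 * log 2 (real n) \<le> real (R_uni \<epsilon> (B2 n t) (B2 n t) (FtFD n))"
      if "16 \<le> n \<and> 1 \<le> t \<and> t \<le> n" for n t :: nat
    proof -
      \<comment> \<open>From \<open>n = 16\<close> on, subtracting 2 from the logarithm costs at
        most half of it. Neither constant depends on \<open>\<epsilon>\<close>.\<close>
      have "4 \<le> log 2 (real n)"
        using that by (subst le_log_iff) auto
      thus ?thesis using R_uni_FtFD_ge[of \<epsilon> t n] \<epsilon> that by simp
    qed
    thus "\<exists>c>0. \<exists>N::nat. \<forall>(n::nat) (t::nat). N \<le> n \<and> 1 \<le> t \<and> t \<le> n \<longrightarrow>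
               c * log 2 (real n) \<le> real (R_uni \<epsilon> (B2 n t) (B2 n t) (FtFD n))"
      by (intro exI[of _ "1 / 2"] conjI exI[of _ 16]) auto
  qed
qed

end
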